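(* Suppose $f:\mathbb R^m\to\mathbb R$ is $\mu_f$-strongly convex and $L_f$-smooth, and $g:\mathbb R^n\to\mathbb R$ is $\mu_g$-strongly convex and $L_g$-smooth, with $\mu_f>0$ and $\mu_g>0$, and let $B$ be a real $n\times m$ matrix. Let $(u^\star,p^\star)$ be the saddle point of $\min_{u\in\mathbb R^m}\max_{p\in\mathbb R^n} f(u)-g(p)+(Bu,p)$. Let $(u_k,v_k,p_k,q_k)$ be generated, with initial value $(u_0,v_0,p_0,q_0)$, by $$\frac{u_{k+1}-u_k}{\alpha}=2v_{k+1}-v_k-u_{k+1},\qquad \frac{p_{k+1}-p_k}{\alpha}=2q_{k+1}-q_k-p_{k+1},$$ $$\frac{v_{k+1}-v_k}{\alpha}=u_k-v_{k+1}-\frac1{\mu_f}\big(\nabla f(u_k)+B^{\intercal}q_k\big),$$ $$\frac{q_{k+1}-q_k}{\alpha}=p_k-q_{k+1}-\frac1{\mu_g}\big(\nabla g(p_k)-2Bv_{k+1}+Bv_k\big),$$ with step size $$\alpha=\max_{\beta\in(0,1)}\min\left\{\sqrt\beta\,\min\left\{\sqrt{\frac{\mu_f}{L_f-\mu_f}},\sqrt{\frac{\mu_g}{L_g-\mu_g}}\right\},\ (1-\beta)\frac{\sqrt{\mu_f\mu_g}}{\|B\|}\right\}.$$ Define $$\mathcal E(u,p,v,q)=D_{f_{-\mu_f}}(u,u^\star)+D_{g_{-\mu_g}}(p,p^\star)+\frac{\mu_f}2\|v-u^\star\|^2+\frac{\mu_g}2\|q-p^\star\|^2,$$ $$\begin{aligned}\mathcal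 E^\alpha(u,p,v,q)={}&\mathcal E(u,p,v,q)-\alpha\big(\nabla f(u)-\nabla f(u^\star)-\mu_f(u-u^\star),\,v-u^\star\big)\\&-\alpha\big(\nabla g(p)-\nabla g(p^\star)-\mu_g(p-p^\star),\,q-p^\star\big)-\alpha\big(B(v-u^\star),\,q-p^\star\big).\end{aligned}$$ Then we have the accelerated linear convergence: for all $k\ge0$, $$\mathcal E^\alpha(u_{k+1},p_{k+1},v_{k+1},q_{k+1})\le\left(\frac1{1+\alpha}\right)^{k+1}\mathcal E^\alpha(u_0,p_0,v_0,q_0),$$ and $$\mathcal E(u_{k+1},p_{k+1},v_{k+1},q_{k+1})\le\frac1\alpha\left(\frac1{1+\alpha}\right)^{k}\mathcal E^\alpha(u_0,p_0,v_0,q_0).$$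
   Context: $(\cdot,\cdot)$ and $\|\cdot\|$ are the Euclidean inner product and norm (spectral norm for matrices). For a function $h$ and $\nu>0$, $h_{-\nu}(x)=h(x)-\frac\nu2\|x\|^2$; $h$ is $\nu$-strongly convex if $h_{-\nu}$ is convex; $L$-smooth means continuously differentiable with $L$-Lipschitz gradient, $0<L<\infty$. $D_h(y,x)=h(y)-h(x)-(\nabla h(x),y-x)$ is the Bregman divergence of $h$. The saddle point satisfies $\nabla f(u^\star)+B^{\intercal}p^\star=0$ and $\nabla g(p^\star)-Bu^\star=0$. *)

theory Defs
  imports "HOL-Analysis.Analysis"
begin

definition grad :: "('a::euclidean_space \<Rightarrow> real) \<Rightarrow> 'a \<Rightarrow> 'a" where
  "grad h x = (THE D. GDERIV h x :> D)"

definition shift :: "real \<Rightarrow> ('a::euclidean_space \<Rightarrow> real) \<Rightarrow> 'a \<Rightarrow> real" where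
  "shift \<nu> h x = h x - \<nu> / 2 * (norm x)\<^sup>2"

definition strongly_convex :: "real \<Rightarrow> ('a::euclidean_space \<Rightarrow> real) \<Rightarrow> bool" where
  "strongly_convex \<nu> h \<longleftrightarrow> 0 < \<nu> \<and> convex_on UNIV (shift \<nu> h)"

definition smooth :: "real \<Rightarrow> ('a::euclidean_space \<Rightarrow> real) \<Rightarrow> bool" where
  "smooth L h \<longleftrightarrow> 0 < L \<and> (\<forall>x. h differentiable (at x)) \<and>
     continuous_on UNIV (grad h) \<and> L-lipschitz_on UNIV (grad h)"

definition bregman :: "('a::euclidean_space \<Rightarrow> real) \<Rightarrow> 'a \<Rightarrow> 'a \<Rightarrow> real" where
  "bregman h y x = h y - h x - grad h x \<bullet> (y - x)"

definition saddle_point ::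
    "('a \<Rightarrow> 'b \<Rightarrow> real) \<Rightarrow> 'a \<Rightarrow> 'b \<Rightarrow> bool" where
  "saddle_point \<Phi> us ps \<longleftrightarrow> (\<forall>u p. \<Phi> us p \<le> \<Phi> us ps \<and> \<Phi> us ps \<le> \<Phi> u ps)"

text \<open>The matrix norm instance of the library is the Frobenius norm, hence the operator norm here.\<close>

definition spectral_norm :: "real^'m^'n \<Rightarrow> real" where
  "spectral_norm B = onorm (\<lambda>x. B *v x)"

text \<open>Quotients with positive numerator and zero denominator in the step size mean infinity,
  that is, they impose no restriction; \<open>L = \<mu>\<close> and \<open>B = 0\<close> are both possible.\<close>

definition sqrt_ratio :: "real \<Rightarrow> real \<Rightarrow> ereal" where
  "sqrt_ratio \<mu> L = (if L = \<mu> then \<infinity> else ereal (sqrt (\<mu> / (L - \<mu>))))"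

definition step_bound ::
    "real \<Rightarrow> real \<Rightarrow> real \<Rightarrow> real \<Rightarrow> real^'m^'n \<Rightarrow> real \<Rightarrow> ereal" where
  "step_bound \<mu>f Lf \<mu>g Lg B \<beta> =
     min (ereal (sqrt \<beta>) * min (sqrt_ratio \<mu>f Lf) (sqrt_ratio \<mu>g Lg))
         (if spectral_norm B = 0 then \<infinity>
          else ereal ((1 - \<beta>) * (sqrt (\<mu>f * \<mu>g) / spectral_norm B)))"

text \<open>The maximum over \<open>0 < \<beta> < 1\<close> is attained exactly if \<open>B \<noteq> 0\<close> and not both ratios are
  infinite. The supremum equals it then, and gives the limiting value in the degenerate cases.
  It is infinite only if \<open>B = 0\<close>, \<open>Lf = \<mu>f\<close> and \<open>Lg = \<mu>g\<close>, when no real step size satisfies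
  the predicate.\<close>

definition optimal_step ::
    "real \<Rightarrow> real \<Rightarrow> real \<Rightarrow> real \<Rightarrow> real^'m^'n \<Rightarrow> real \<Rightarrow> bool" where
  "optimal_step \<mu>f Lf \<mu>g Lg B \<alpha> \<longleftrightarrow>
     ereal \<alpha> = (SUP \<beta>\<in>{0<..<1}. step_bound \<mu>f Lf \<mu>g Lg B \<beta>)"

definition lyap ::
    "(real^'m \<Rightarrow> real) \<Rightarrow> (real^'n \<Rightarrow> real) \<Rightarrow> real \<Rightarrow> real \<Rightarrow> real^'m \<Rightarrow> real^'n \<Rightarrow>
     real^'m \<Rightarrow> real^'n \<Rightarrow> real^'m \<Rightarrow> real^'n \<Rightarrow> real" where
  "lyap f g \<mu>f \<mu>g us ps u p v q =
     bregman (shift \<mu>f f) u us + bregman (shift \<mu>g g) p ps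
     + \<mu>f / 2 * (norm (v - us))\<^sup>2 + \<mu>g / 2 * (norm (q - ps))\<^sup>2"

definition lyap_mod ::
    "(real^'m \<Rightarrow> real) \<Rightarrow> (real^'n \<Rightarrow> real) \<Rightarrow> real \<Rightarrow> real \<Rightarrow> real^'m^'n \<Rightarrow> real \<Rightarrow>
     real^'m \<Rightarrow> real^'n \<Rightarrow> real^'m \<Rightarrow> real^'n \<Rightarrow> real^'m \<Rightarrow> real^'n \<Rightarrow> real" where
  "lyap_mod f g \<mu>f \<mu>g B \<alpha> us ps u p v q =
     lyap f g \<mu>f \<mu>g us ps u p v q
     - \<alpha> * ((grad f u - grad f us - \<mu>f *\<^sub>R (u - us)) \<bullet> (v - us))
     - \<alpha> * ((grad g p - grad g ps - \<mu>g *\<^sub>R (p - ps)) \<bullet> (q - ps))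
     - \<alpha> * ((B *v (v - us)) \<bullet> (q - ps))"

end

theory Submission
  imports Defs
begin

text \<open>Write \<open>F = shift \<mu>f f\<close> and \<open>G = shift \<mu>g g\<close>, and denote the energy and the modified energy at
  step \<open>k\<close> by \<open>E k\<close> and \<open>E\<alpha> k\<close>. The stationarity conditions at the saddle point turn the scheme
  into an iteration for the deviations from \<open>(us, ps)\<close>. In the updates of \<open>v\<close> and \<open>q\<close>, the terms
  \<open>u k\<close> and \<open>p k\<close> cancel the quadratic parts of \<open>f\<close> and \<open>g\<close>, so only the gradients of \<open>F\<close> and \<open>G\<close>
  remain.

  The scheme is close to an implicit Euler step for a flow along which \<open>E\<close> decays exponentially; it
  differs in that the gradients and \<open>q\<close> are taken at old points, and compensates for this by
  extrapolating \<open>v\<close> and \<open>q\<close>. The errors that are left pair increments with increments, or are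
  differences of the same expression at steps \<open>k + 1\<close> and \<open>k\<close>. The latter are the changes of the
  three products subtracted in \<open>E\<alpha>\<close>, so that (\<open>block_energy_identity\<close>, used for both blocks of
  variables) \<open>E\<alpha> (k + 1) - E\<alpha> k\<close> equals
  \<open>- \<alpha> * E (k + 1)\<close>, minus \<open>\<alpha>\<close> times the dual energy of the new point
  (\<open>bregman F us u' + bregman G ps p'\<close> and the quadratic terms once more), minus the energy of the
  increment, plus \<open>\<alpha>\<close> times inner products of increments.

  One inequality, \<open>cross_terms_le\<close>, then does all the estimating: for the given step size, \<open>\<alpha>\<close> times
  such inner products is at most the corresponding energy. Applied to the increment, it removes the
  error terms; applied to the new point in dual form, it turns the remaining dissipation into
  \<open>(1 + \<alpha>) * E\<alpha> (k + 1) \<le> E\<alpha> k\<close>; applied to the new point itself, it gives \<open>0 \<le> E\<alpha> (k + 1)\<close>, whence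
  \<open>\<alpha> * E (k + 1) \<le> E\<alpha> k\<close>. The two claims follow by iteration.

  The inequality rests on \<open>grad_diff_inner_le_bregman\<close> for the gradient products and on
  Cauchy-Schwarz for the coupling. In the definition of the step size, \<open>\<beta>\<close> is the share
  of the quadratic terms that is spent on the gradient products, and \<open>1 - \<beta>\<close> the share spent on the
  coupling.\<close>

section \<open>Gradients and Bregman divergences\<close>

lemma GDERIV_unique:
  fixes h :: "'a::real_inner \<Rightarrow> real"
  assumes "GDERIV h x :> D" and "GDERIV h x :> D'"
  shows "D = D'"
proof -
  have "(\<lambda>w. w \<bullet> D) = (\<lambda>w. w \<bullet> D')"
    using assms unfolding gderiv_def by (rule has_derivative_unique)
  then have "(D - D') \<bullet> D = (D - D') \<bullet> D'"
    by metis
  then have "(D - D') \<bullet> (D - D') = 0"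
    by (simp add: inner_diff_right)
  then show ?thesis
    by simp
qed

lemma GDERIV_grad:
  fixes h :: "'a::euclidean_space \<Rightarrow> real"
  assumes "h differentiable (at x)"
  shows "GDERIV h x :> grad h x"
proof -
  from assms obtain h' where h': "(h has_derivative h') (at x)"
    by (auto simp: differentiable_def)
  then interpret bounded_linear h'
    by (rule has_derivative_bounded_linear)
  have "h' = (\<lambda>w. w \<bullet> (\<Sum>b\<in>Basis. h' b *\<^sub>R b))"
  proof
    fix w
    have "h' w = h' (\<Sum>b\<in>Basis. (w \<bullet> b) *\<^sub>R b)"
      by (simp add: euclidean_representation)
    also have "\<dots> = (\<Sum>b\<in>Basis. (w \<bullet> b) * h' b)"
      by (simp add: sum scaleR)
    also have "\<dots> = w \<bullet> (\<Sum>b\<in>Basis. h' b *\<^sub>R b)"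
      by (simp add: inner_sum_right mult.commute)
    finally show "h' w = w \<bullet> (\<Sum>b\<in>Basis. h' b *\<^sub>R b)" .
  qed
  with h' have ex: "GDERIV h x :> (\<Sum>b\<in>Basis. h' b *\<^sub>R b)"
    by (simp add: gderiv_def)
  with ex show ?thesis
    unfolding grad_def by (metis the_equality GDERIV_unique)
qed

lemma grad_eqI:
  fixes h :: "'a::euclidean_space \<Rightarrow> real"
  assumes "GDERIV h x :> D"
  shows "grad h x = D"
proof -
  have "h differentiable (at x)"
    using assms by (auto simp: gderiv_def differentiable_def)
  then show ?thesis
    using assms by (intro GDERIV_unique[OF GDERIV_grad])
qed

lemma GDERIV_shift:
  assumes "h differentiable (at x)"
  shows "GDERIV (shift \<nu> h) x :> grad h x - \<nu> *\<^sub>R x"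
proof -
  have "(h has_derivative (\<lambda>w. w \<bullet> grad h x)) (at x)"
    using GDERIV_grad[OF assms] by (simp add: gderiv_def)
  then show ?thesis
    unfolding gderiv_def shift_def power2_norm_eq_inner
    by (auto intro!: derivative_eq_intros simp: algebra_simps inner_commute)
qed

lemmas grad_shift = GDERIV_shift[THEN grad_eqI]

lemma differentiable_shift:
  assumes "h differentiable (at x)"
  shows "shift \<nu> h differentiable (at x)"
  using GDERIV_shift[OF assms] by (auto simp: gderiv_def differentiable_def)

lemma bregman_shift:
  assumes "\<And>x. h differentiable (at x)"
  shows "bregman (shift \<nu> h) y x = bregman h y x - \<nu> / 2 * (norm (y - x))\<^sup>2"
  unfolding bregman_def grad_shift[OF assms] shift_def power2_norm_eq_inner
  by (simp add: algebra_simps inner_commute)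

lemma DERIV_along_line:
  fixes h :: "'a::euclidean_space \<Rightarrow> real" and t :: real
  assumes "h differentiable (at (x + t *\<^sub>R d))"
  shows "((\<lambda>t. h (x + t *\<^sub>R d)) has_real_derivative grad h (x + t *\<^sub>R d) \<bullet> d) (at t)"
proof -
  have "(h has_derivative (\<lambda>w. w \<bullet> grad h (x + t *\<^sub>R d))) (at (x + t *\<^sub>R d))"
    using GDERIV_grad[OF assms] by (simp add: gderiv_def)
  moreover have "((\<lambda>t. x + t *\<^sub>R d) has_derivative (\<lambda>s. s *\<^sub>R d)) (at t)"
    by (auto intro!: derivative_eq_intros)
  ultimately have "((\<lambda>t. h (x + t *\<^sub>R d)) has_derivative
      (\<lambda>s. (s *\<^sub>R d) \<bullet> grad h (x + t *\<^sub>R d))) (at t)"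
    by (rule has_derivative_compose[rotated])
  then show ?thesis
    by (simp add: has_field_derivative_def inner_commute mult_commute_abs)
qed

lemma bregman_nonneg:
  fixes h :: "'a::euclidean_space \<Rightarrow> real"
  assumes "convex_on UNIV h" and "h differentiable (at x)"
  shows "0 \<le> bregman h y x"
proof -
  let ?\<phi> = "\<lambda>t. h (x + t *\<^sub>R (y - x))"
  have "convex_on UNIV ?\<phi>"
  proof (rule convex_onI)
    fix t s s' :: real
    assume t: "0 < t" "t < 1"
    have "x + ((1 - t) *\<^sub>R s + t *\<^sub>R s') *\<^sub>R (y - x)
        = (1 - t) *\<^sub>R (x + s *\<^sub>R (y - x)) + t *\<^sub>R (x + s' *\<^sub>R (y - x))"
      by (simp add: algebra_simps)
    with t show "?\<phi> ((1 - t) *\<^sub>R s + t *\<^sub>R s') \<le> (1 - t) * ?\<phi> s + t * ?\<phi> s'"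
      using convex_onD[OF assms(1), of t "x + s *\<^sub>R (y - x)" "x + s' *\<^sub>R (y - x)"] by simp
  qed simp
  moreover have "(?\<phi> has_real_derivative grad h x \<bullet> (y - x)) (at 0)"
    using DERIV_along_line[of h x 0 "y - x"] assms(2) by simp
  ultimately have "?\<phi> 1 - ?\<phi> 0 \<ge> grad h x \<bullet> (y - x) * (1 - 0)"
    by (intro convex_on_imp_above_tangent[where A = UNIV]) auto
  then show ?thesis
    by (simp add: bregman_def)
qed

text \<open>The constant \<open>1 / 2\<close> comes from integrating the Lipschitz bound
  \<open>(grad h (x + t *\<^sub>R d) - grad h x) \<bullet> d \<le> L * t * (norm d)\<^sup>2\<close> over \<open>t\<close>; instead of an integral, the
  proof uses that the difference of the two sides of the integrated bound is monotone in \<open>t\<close>.\<close>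

lemma bregman_le_smooth:
  fixes h :: "'a::euclidean_space \<Rightarrow> real"
  assumes "smooth L h"
  shows "bregman h y x \<le> L / 2 * (norm (y - x))\<^sup>2"
proof -
  let ?d = "y - x"
  let ?\<psi> = "\<lambda>t. h (x + t *\<^sub>R ?d) - t * (grad h x \<bullet> ?d) - L / 2 * t\<^sup>2 * (norm ?d)\<^sup>2"
  have diff: "h differentiable (at z)" for z
    using assms by (simp add: smooth_def)
  have "?\<psi> 1 \<le> ?\<psi> 0"
  proof (rule DERIV_nonpos_imp_nonincreasing[where f = ?\<psi> and a = 0 and b = 1])
    fix t :: real
    assume t: "0 \<le> t" "t \<le> 1"
    let ?D = "grad h (x + t *\<^sub>R ?d) \<bullet> ?d - grad h x \<bullet> ?d - L * t * (norm ?d)\<^sup>2"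
    have "(?\<psi> has_real_derivative ?D) (at t)"
      using DERIV_along_line[OF diff, where x = x and t = t and d = ?d]
      by (auto intro!: derivative_eq_intros)
    moreover have "?D \<le> 0"
    proof -
      have "dist (grad h (x + t *\<^sub>R ?d)) (grad h x) \<le> L * dist (x + t *\<^sub>R ?d) x"
        using assms by (auto simp: smooth_def intro: lipschitz_onD)
      then have lip: "norm (grad h (x + t *\<^sub>R ?d) - grad h x) \<le> L * t * norm ?d"
        using t by (simp add: dist_norm)
      have "(grad h (x + t *\<^sub>R ?d) - grad h x) \<bullet> ?d
          \<le> norm (grad h (x + t *\<^sub>R ?d) - grad h x) * norm ?d"
        by (rule norm_cauchy_schwarz)
      also have "\<dots> \<le> L * t * norm ?d * norm ?d"
        using lip by (rule mult_right_mono) simp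
      finally show ?thesis
        by (simp add: inner_diff_left power2_eq_square mult.assoc)
    qed
    ultimately show "\<exists>D. (?\<psi> has_real_derivative D) (at t) \<and> D \<le> 0"
      by blast
  qed simp
  then show ?thesis
    by (simp add: bregman_def)
qed

text \<open>Young's inequality for the gradient increment. Optimising over \<open>w\<close> would give co-coercivity,
  \<open>(norm (grad h x - grad h y))\<^sup>2 \<le> 2 * M * bregman h x y\<close>; in the form with a free \<open>w\<close> the
  case \<open>M = 0\<close> is included. The inequality says that the function
  \<open>\<lambda>z. bregman h z y\<close>, whose minimum is \<open>0\<close>, is nonnegative at the point \<open>x - w\<close>, reached from
  \<open>x\<close> at a cost of at most \<open>M / 2 * (norm w)\<^sup>2\<close> beyond first order.\<close>

lemma grad_diff_inner_le_bregman:
  assumes nonneg: "\<And>z y. 0 \<le> bregman h z y"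
    and upper: "\<And>z y. bregman h z y \<le> M / 2 * (norm (z - y))\<^sup>2"
  shows "(grad h x - grad h y) \<bullet> w \<le> bregman h x y + M / 2 * (norm w)\<^sup>2"
proof -
  have "bregman h (x - w) y = bregman h x y + bregman h (x - w) x - (grad h x - grad h y) \<bullet> w"
    by (simp add: bregman_def algebra_simps)
  moreover have "bregman h (x - w) x \<le> M / 2 * (norm w)\<^sup>2"
    using upper[of "x - w" x] by simp
  ultimately show ?thesis
    using nonneg[of "x - w" y] by linarith
qed

context
  fixes h :: "'a::euclidean_space \<Rightarrow> real" and \<mu> L :: real
  assumes strong: "strongly_convex \<mu> h" and smooth: "smooth L h"
begin

lemma bregman_shift_bounds:
  shows "0 \<le> bregman (shift \<mu> h) y x"
    and "bregman (shift \<mu> h) y x \<le> (L - \<mu>) / 2 * (norm (y - x))\<^sup>2"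
proof -
  have diff: "h differentiable (at z)" for z
    using smooth by (simp add: smooth_def)
  show "0 \<le> bregman (shift \<mu> h) y x"
    using strong by (intro bregman_nonneg differentiable_shift diff) (simp add: strongly_convex_def)
  show "bregman (shift \<mu> h) y x \<le> (L - \<mu>) / 2 * (norm (y - x))\<^sup>2"
    using bregman_le_smooth[OF smooth, of y x]
    by (simp add: bregman_shift[OF diff] algebra_simps diff_divide_distrib)
qed

text \<open>The space contains a unit vector, so the two bounds on the divergence can be compared.\<close>

lemma strong_convexity_le_smoothness: "\<mu> \<le> L"
proof -
  obtain b :: 'a where "b \<in> Basis"
    using nonempty_Basis by blast
  then have "norm b = 1"
    by simp
  with bregman_shift_bounds[of b 0] show ?thesis
    by simp
qed

lemma grad_shift_diff_inner_le:
  "(grad (shift \<mu> h) x - grad (shift \<mu> h) y) \<bullet> w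
    \<le> bregman (shift \<mu> h) x y + (L - \<mu>) / 2 * (norm w)\<^sup>2"
  by (intro grad_diff_inner_le_bregman bregman_shift_bounds)

end

lemma grad_at_minimum_of_linear_perturbation:
  fixes h :: "'a::euclidean_space \<Rightarrow> real"
  assumes "h differentiable (at x)" and min: "\<And>y. h x + x \<bullet> c \<le> h y + y \<bullet> c"
  shows "grad h x = - c"
proof -
  have "(h has_derivative (\<lambda>w. w \<bullet> grad h x)) (at x)"
    using GDERIV_grad[OF assms(1)] by (simp add: gderiv_def)
  then have "((\<lambda>y. h y + y \<bullet> c) has_derivative (\<lambda>w. w \<bullet> grad h x + w \<bullet> c)) (at x)"
    by (auto intro!: derivative_eq_intros)
  then have "(\<lambda>w. w \<bullet> grad h x + w \<bullet> c) = (\<lambda>w. 0)"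
    using min by (intro differential_zero_maxmin[where S = UNIV]) auto
  then have "(grad h x + c) \<bullet> grad h x + (grad h x + c) \<bullet> c = 0"
    by metis
  then have "(grad h x + c) \<bullet> (grad h x + c) = 0"
    by (simp add: inner_add_right)
  then show ?thesis
    by (simp add: eq_neg_iff_add_eq_0)
qed

lemma matrix_inner_le_spectral_norm:
  fixes B :: "real^'m^'n"
  shows "\<bar>(B *v x) \<bullet> y\<bar> \<le> spectral_norm B * (norm x * norm y)"
proof -
  have "\<bar>(B *v x) \<bullet> y\<bar> \<le> norm (B *v x) * norm y"
    by (rule Cauchy_Schwarz_ineq2)
  also have "\<dots> \<le> (spectral_norm B * norm x) * norm y"
    unfolding spectral_norm_def
    by (intro mult_right_mono onorm matrix_vector_mul_bounded_linear) simp
  finally show ?thesis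
    by (simp add: mult.assoc)
qed

section \<open>The step size\<close>

lemma less_sqrt_ratioD:
  assumes "ereal a < ereal (sqrt \<beta>) * sqrt_ratio \<mu> L"
    and "0 \<le> a" "0 < \<beta>" "0 < \<mu>" "\<mu> \<le> L"
  shows "a\<^sup>2 * (L - \<mu>) \<le> \<beta> * \<mu>"
proof (cases "L = \<mu>")
  case False
  with assms have "a < sqrt \<beta> * sqrt (\<mu> / (L - \<mu>))"
    by (simp add: sqrt_ratio_def)
  with \<open>0 \<le> a\<close> have "a\<^sup>2 \<le> (sqrt \<beta> * sqrt (\<mu> / (L - \<mu>)))\<^sup>2"
    by (intro power_mono) simp_all
  also have "\<dots> = \<beta> * (\<mu> / (L - \<mu>))"
    using assms by (simp add: power_mult_distrib)
  finally show ?thesis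
    using False assms by (simp add: field_simps)
qed (use assms in simp)

text \<open>Every \<open>a\<close> with \<open>0 < a < \<alpha>\<close> meets the two bounds for some \<open>\<beta>\<close>, which is then eliminated; the resulting
  inequality is a polynomial one, so it passes to the limit \<open>a \<rightarrow> \<alpha>\<close>, and
  \<open>\<beta> = 1 - \<alpha> * spectral_norm B / sqrt (\<mu>f * \<mu>g)\<close> serves for \<open>\<alpha>\<close> itself. This covers the cases in
  which the supremum is not attained.\<close>

lemma optimal_stepE:
  fixes B :: "real^'m^'n"
  assumes "optimal_step \<mu>f Lf \<mu>g Lg B \<alpha>"
    and pos: "0 < \<mu>f" "0 < \<mu>g" and le: "\<mu>f \<le> Lf" "\<mu>g \<le> Lg"
  obtains \<beta> where "0 < \<alpha>"
    and "\<alpha>\<^sup>2 * (Lf - \<mu>f) \<le> \<beta> * \<mu>f" and "\<alpha>\<^sup>2 * (Lg - \<mu>g) \<le> \<beta> * \<mu>g"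
    and "\<alpha> * spectral_norm B \<le> (1 - \<beta>) * sqrt (\<mu>f * \<mu>g)"
proof -
  let ?s = "sqrt (\<mu>f * \<mu>g)" and ?b = "spectral_norm B"
  have sup: "ereal \<alpha> = (SUP \<beta>\<in>{0<..<1}. step_bound \<mu>f Lf \<mu>g Lg B \<beta>)"
    using assms(1) by (simp add: optimal_step_def)
  have s: "0 < ?s"
    using pos by simp
  have b: "0 \<le> ?b"
    unfolding spectral_norm_def by (intro onorm_pos_le matrix_vector_mul_bounded_linear)
  have ratio_pos: "0 < sqrt_ratio \<mu> L" if "0 < \<mu>" "\<mu> \<le> L" for \<mu> L
    using that by (simp add: sqrt_ratio_def)
  have "0 < step_bound \<mu>f Lf \<mu>g Lg B (1 / 2)"
    using b pos le by (auto simp: step_bound_def ratio_pos ereal_zero_less_0_iff)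
  also have "\<dots> \<le> ereal \<alpha>"
    unfolding sup by (rule SUP_upper) simp
  finally have \<alpha>: "0 < \<alpha>"
    by simp
  have below: "a\<^sup>2 * (Lf - \<mu>f) \<le> (1 - a * ?b / ?s) * \<mu>f \<and> a\<^sup>2 * (Lg - \<mu>g) \<le> (1 - a * ?b / ?s) * \<mu>g"
    if a: "0 < a" "a < \<alpha>" for a
  proof -
    have "ereal a < (SUP \<beta>\<in>{0<..<1}. step_bound \<mu>f Lf \<mu>g Lg B \<beta>)"
      using a sup by (metis ereal_less_eq(3) linorder_not_le)
    then obtain \<beta> where \<beta>: "0 < \<beta>" "\<beta> < 1" and *: "ereal a < step_bound \<mu>f Lf \<mu>g Lg B \<beta>"
      unfolding less_SUP_iff by auto
    from * have lt_min: "ereal a < ereal (sqrt \<beta>) * min (sqrt_ratio \<mu>f Lf) (sqrt_ratio \<mu>g Lg)"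
      and lt_b: "?b \<noteq> 0 \<Longrightarrow> a < (1 - \<beta>) * (?s / ?b)"
      by (auto simp: step_bound_def)
    have sq: "0 \<le> ereal (sqrt \<beta>)"
      using \<beta> by simp
    have "ereal a < ereal (sqrt \<beta>) * sqrt_ratio \<mu>f Lf"
      by (rule less_le_trans[OF lt_min]) (intro ereal_mult_left_mono sq min.cobounded1)
    then have f: "a\<^sup>2 * (Lf - \<mu>f) \<le> \<beta> * \<mu>f"
      using a \<beta> pos le by (intro less_sqrt_ratioD) auto
    have "ereal a < ereal (sqrt \<beta>) * sqrt_ratio \<mu>g Lg"
      by (rule less_le_trans[OF lt_min]) (intro ereal_mult_left_mono sq min.cobounded2)
    then have g: "a\<^sup>2 * (Lg - \<mu>g) \<le> \<beta> * \<mu>g"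
      using a \<beta> pos le by (intro less_sqrt_ratioD) auto
    have "a * ?b \<le> (1 - \<beta>) * ?s"
      using lt_b b s \<beta> by (cases "?b = 0") (auto simp: field_simps)
    then have "a * ?b / ?s \<le> 1 - \<beta>"
      using s by (simp only: pos_divide_le_eq)
    then have "\<beta> \<le> 1 - a * ?b / ?s"
      by simp
    then show ?thesis
      using f g pos by (meson mult_right_mono less_imp_le order_trans)
  qed
  have ev: "\<forall>\<^sub>F a in at_left \<alpha>. 0 < a \<and> a < \<alpha>"
    using eventually_at_left_real[OF \<alpha>] by simp
  have limit: "\<alpha>\<^sup>2 * M \<le> (1 - \<alpha> * ?b / ?s) * \<mu>"
    if M: "\<And>a. 0 < a \<Longrightarrow> a < \<alpha> \<Longrightarrow> a\<^sup>2 * M \<le> (1 - a * ?b / ?s) * \<mu>" for M \<mu>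
  proof (rule tendsto_le[of "at_left \<alpha>"])
    show "((\<lambda>a. (1 - a * ?b / ?s) * \<mu>) \<longlongrightarrow> (1 - \<alpha> * ?b / ?s) * \<mu>) (at_left \<alpha>)"
      using s by (intro tendsto_intros) auto
    show "((\<lambda>a. a\<^sup>2 * M) \<longlongrightarrow> \<alpha>\<^sup>2 * M) (at_left \<alpha>)"
      by (intro tendsto_intros)
    show "\<forall>\<^sub>F a in at_left \<alpha>. a\<^sup>2 * M \<le> (1 - a * ?b / ?s) * \<mu>"
      using ev by eventually_elim (use M in blast)
  qed simp
  show ?thesis
  proof (rule that[of "1 - \<alpha> * ?b / ?s"])
    show "\<alpha> * ?b \<le> (1 - (1 - \<alpha> * ?b / ?s)) * ?s"
      using pos by simp
  qed (use \<alpha> limit below in blast)+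
qed

section \<open>One step of the iteration\<close>

text \<open>Each gradient product is controlled by its Bregman divergence plus the fraction \<open>\<beta>\<close> of the
  quadratic term in the same variable; this takes \<open>w = \<alpha> *\<^sub>R v\<close> in the Young inequality above. The
  coupling, which mixes the two variables, is controlled by the remaining fraction \<open>1 - \<beta>\<close> of both
  quadratic terms. The absolute value makes the bound applicable with either sign of the coupling,
  and exchanging \<open>x\<close> with \<open>y\<close> and \<open>r\<close> with \<open>s\<close> gives the other sign of the gradient products.\<close>

lemma cross_terms_le:
  fixes f :: "real^'m \<Rightarrow> real" and g :: "real^'n \<Rightarrow> real" and B :: "real^'m^'n"
  assumes f: "strongly_convex \<mu>f f" "smooth Lf f"
    and g: "strongly_convex \<mu>g g" "smooth Lg g"
    and step: "0 < \<alpha>" "\<alpha>\<^sup>2 * (Lf - \<mu>f) \<le> \<beta> * \<mu>f" "\<alpha>\<^sup>2 * (Lg - \<mu>g) \<le> \<beta> * \<mu>g"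
      "\<alpha> * spectral_norm B \<le> (1 - \<beta>) * sqrt (\<mu>f * \<mu>g)"
  defines "F \<equiv> shift \<mu>f f" and "G \<equiv> shift \<mu>g g"
  shows "\<alpha> * ((grad F x - grad F y) \<bullet> v) + \<alpha> * ((grad G r - grad G s) \<bullet> q) + \<alpha> * \<bar>(B *v v) \<bullet> q\<bar>
    \<le> bregman F x y + bregman G r s + \<mu>f / 2 * (norm v)\<^sup>2 + \<mu>g / 2 * (norm q)\<^sup>2"
proof -
  have pos: "0 < \<mu>f" "0 < \<mu>g"
    using f g by (simp_all add: strongly_convex_def)
  have scale: "\<alpha> * (c \<bullet> w) \<le> D + \<beta> * \<mu> / 2 * (norm w)\<^sup>2"
    if "c \<bullet> (\<alpha> *\<^sub>R w) \<le> D + M / 2 * (norm (\<alpha> *\<^sub>R w))\<^sup>2" "\<alpha>\<^sup>2 * M \<le> \<beta> * \<mu>"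
    for c w :: "'c::real_inner" and D M \<mu>
  proof -
    have "(\<alpha>\<^sup>2 * M) * ((norm w)\<^sup>2 / 2) \<le> (\<beta> * \<mu>) * ((norm w)\<^sup>2 / 2)"
      using that(2) by (intro mult_right_mono) auto
    with that(1) show ?thesis
      by (simp add: power_mult_distrib algebra_simps)
  qed
  have "\<alpha> * ((grad F x - grad F y) \<bullet> v) \<le> bregman F x y + \<beta> * \<mu>f / 2 * (norm v)\<^sup>2"
    unfolding F_def by (rule scale[OF grad_shift_diff_inner_le[OF f] step(2)])
  moreover have "\<alpha> * ((grad G r - grad G s) \<bullet> q) \<le> bregman G r s + \<beta> * \<mu>g / 2 * (norm q)\<^sup>2"
    unfolding G_def by (rule scale[OF grad_shift_diff_inner_le[OF g] step(3)])
  moreover have "\<alpha> * \<bar>(B *v v) \<bullet> q\<bar> \<le> (1 - \<beta>) * (\<mu>f / 2 * (norm v)\<^sup>2 + \<mu>g / 2 * (norm q)\<^sup>2)"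
  proof -
    have nonneg: "0 \<le> 1 - \<beta>"
    proof -
      have "0 \<le> \<alpha> * spectral_norm B"
        using step(1) unfolding spectral_norm_def
        by (intro mult_nonneg_nonneg onorm_pos_le matrix_vector_mul_bounded_linear) simp
      with step(4) pos show ?thesis
        by (metis mult_pos_pos order_trans real_sqrt_gt_0_iff zero_le_mult_iff linorder_not_le)
    qed
    have "\<alpha> * \<bar>(B *v v) \<bullet> q\<bar> \<le> \<alpha> * (spectral_norm B * (norm v * norm q))"
      using step(1) by (intro mult_left_mono matrix_inner_le_spectral_norm) simp
    also have "\<dots> = (\<alpha> * spectral_norm B) * (norm v * norm q)"
      by simp
    also have "\<dots> \<le> ((1 - \<beta>) * sqrt (\<mu>f * \<mu>g)) * (norm v * norm q)"
      by (rule mult_right_mono[OF step(4)]) simp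
    also have "\<dots> = (1 - \<beta>) * ((sqrt \<mu>f * norm v) * (sqrt \<mu>g * norm q))"
      by (simp add: real_sqrt_mult)
    also have "\<dots> \<le> (1 - \<beta>) * (\<mu>f / 2 * (norm v)\<^sup>2 + \<mu>g / 2 * (norm q)\<^sup>2)"
    proof (rule mult_left_mono[OF _ nonneg])
      show "(sqrt \<mu>f * norm v) * (sqrt \<mu>g * norm q) \<le> \<mu>f / 2 * (norm v)\<^sup>2 + \<mu>g / 2 * (norm q)\<^sup>2"
        using sum_squares_bound[of "sqrt \<mu>f * norm v" "sqrt \<mu>g * norm q"] pos
        by (simp add: power_mult_distrib)
    qed
    finally show ?thesis .
  qed
  ultimately show ?thesis
    by (simp add: algebra_simps diff_divide_distrib)
qed

text \<open>The energy balance of one block \<open>(u, v)\<close>; the vector \<open>r\<close> stands for the force that the other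
  block exerts through the coupling. The update of \<open>v\<close> uses the old gradient, so testing it
  with \<open>v' - us\<close> produces \<open>\<phi> u \<bullet> (v' - us)\<close>, whereas the update of \<open>u\<close> tested with \<open>\<phi> u'\<close> produces
  \<open>\<phi> u' \<bullet> (v' - us) + \<phi> u' \<bullet> (v' - v)\<close>; the second summand is due to the extrapolation
  \<open>2 *\<^sub>R v' - v\<close>. It is exactly what makes the mismatch equal to
  \<open>\<phi> u' \<bullet> (v' - us) - \<phi> u \<bullet> (v - us)\<close>, which the modified energy absorbs, plus a product of
  increments.\<close>

lemma block_energy_identity:
  fixes F :: "'a::euclidean_space \<Rightarrow> real"
  assumes U: "u' - u = \<alpha> *\<^sub>R (2 *\<^sub>R v' - v - u')"
    and V: "\<mu> *\<^sub>R (v' - v) = - \<alpha> *\<^sub>R (\<mu> *\<^sub>R (v' - us) + (grad F u - grad F us) + r)"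
  defines "e \<equiv> \<lambda>u v. bregman F u us + \<mu> / 2 * (norm (v - us))\<^sup>2"
    and "\<phi> \<equiv> \<lambda>u. grad F u - grad F us"
  shows "(e u' v' - \<alpha> * (\<phi> u' \<bullet> (v' - us))) - (e u v - \<alpha> * (\<phi> u \<bullet> (v - us)))
    = - \<alpha> * e u' v' - \<alpha> * (bregman F us u' + \<mu> / 2 * (norm (v' - us))\<^sup>2)
      - (bregman F u u' + \<mu> / 2 * (norm (v' - v))\<^sup>2 - \<alpha> * ((grad F u' - grad F u) \<bullet> (v' - v)))
      - \<alpha> * (r \<bullet> (v' - us))"
proof -
  have u_part: "bregman F u' us - bregman F u us + bregman F u u' = \<phi> u' \<bullet> (u' - u)"
    by (simp add: bregman_def \<phi>_def algebra_simps)
  have "\<phi> u' \<bullet> (u' - u) = \<alpha> * (\<phi> u' \<bullet> (v' - us) + \<phi> u' \<bullet> (v' - v) - \<phi> u' \<bullet> (u' - us))"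
    unfolding U by (simp add: algebra_simps flip: scaleR_2)
  moreover have "\<phi> u' \<bullet> (u' - us) = bregman F u' us + bregman F us u'"
    by (simp add: bregman_def \<phi>_def algebra_simps)
  ultimately have U': "bregman F u' us - bregman F u us + bregman F u u'
      = \<alpha> * (\<phi> u' \<bullet> (v' - us) + \<phi> u' \<bullet> (v' - v) - (bregman F u' us + bregman F us u'))"
    using u_part by simp
  have "\<mu> / 2 * (norm (v' - us))\<^sup>2 - \<mu> / 2 * (norm (v - us))\<^sup>2 + \<mu> / 2 * (norm (v' - v))\<^sup>2
      = (\<mu> *\<^sub>R (v' - v)) \<bullet> (v' - us)"
    by (simp add: power2_norm_eq_inner algebra_simps inner_commute)
  also have "\<dots> = - \<alpha> * (\<mu> * (norm (v' - us))\<^sup>2 + \<phi> u \<bullet> (v' - us) + r \<bullet> (v' - us))"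
    unfolding V by (simp add: power2_norm_eq_inner inner_add_left \<phi>_def)
  finally have V': "\<mu> / 2 * (norm (v' - us))\<^sup>2 - \<mu> / 2 * (norm (v - us))\<^sup>2 + \<mu> / 2 * (norm (v' - v))\<^sup>2
      = - \<alpha> * (\<mu> * (norm (v' - us))\<^sup>2 + \<phi> u \<bullet> (v' - us) + r \<bullet> (v' - us))" .
  have "\<alpha> * ((grad F u' - grad F u) \<bullet> (v' - v))
      = \<alpha> * (\<phi> u' \<bullet> (v' - v) - \<phi> u \<bullet> (v' - us) + \<phi> u \<bullet> (v - us))"
    by (simp add: \<phi>_def algebra_simps)
  then show ?thesis
    using U' V' unfolding e_def by (simp add: algebra_simps)
qed

section \<open>Convergence\<close>

theorem theorem7p2:
  fixes f :: "real^'m \<Rightarrow> real" and g :: "real^'n \<Rightarrow> real"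
    and B :: "real^'m^'n"
    and \<mu>f Lf \<mu>g Lg \<alpha> :: real
    and us :: "real^'m" and ps :: "real^'n"
    and u v :: "nat \<Rightarrow> real^'m" and p q :: "nat \<Rightarrow> real^'n"
  assumes "\<mu>f > 0" and "\<mu>g > 0"
    and "strongly_convex \<mu>f f" and "smooth Lf f"
    and "strongly_convex \<mu>g g" and "smooth Lg g"
    and "saddle_point (\<lambda>u p. f u - g p + (B *v u) \<bullet> p) us ps"
    and "optimal_step \<mu>f Lf \<mu>g Lg B \<alpha>"
    and "\<And>k. (1 / \<alpha>) *\<^sub>R (u (Suc k) - u k) = 2 *\<^sub>R v (Suc k) - v k - u (Suc k)"
    and "\<And>k. (1 / \<alpha>) *\<^sub>R (p (Suc k) - p k) = 2 *\<^sub>R q (Suc k) - q k - p (Suc k)"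
    and "\<And>k. (1 / \<alpha>) *\<^sub>R (v (Suc k) - v k) =
           u k - v (Suc k) - (1 / \<mu>f) *\<^sub>R (grad f (u k) + transpose B *v q k)"
    and "\<And>k. (1 / \<alpha>) *\<^sub>R (q (Suc k) - q k) =
           p k - q (Suc k) - (1 / \<mu>g) *\<^sub>R (grad g (p k) - 2 *\<^sub>R (B *v v (Suc k)) + B *v v k)"
  shows "\<forall>k. lyap_mod f g \<mu>f \<mu>g B \<alpha> us ps (u (k + 1)) (p (k + 1)) (v (k + 1)) (q (k + 1))
             \<le> (1 / (1 + \<alpha>)) ^ (k + 1) * lyap_mod f g \<mu>f \<mu>g B \<alpha> us ps (u 0) (p 0) (v 0) (q 0)
           \<and> lyap f g \<mu>f \<mu>g us ps (u (k + 1)) (p (k + 1)) (v (k + 1)) (q (k + 1))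
             \<le> 1 / \<alpha> * (1 / (1 + \<alpha>)) ^ k * lyap_mod f g \<mu>f \<mu>g B \<alpha> us ps (u 0) (p 0) (v 0) (q 0)"
proof -
  let ?F = "shift \<mu>f f" and ?G = "shift \<mu>g g"
  let ?E = "\<lambda>k. lyap f g \<mu>f \<mu>g us ps (u k) (p k) (v k) (q k)"
  let ?E\<alpha> = "\<lambda>k. lyap_mod f g \<mu>f \<mu>g B \<alpha> us ps (u k) (p k) (v k) (q k)"
  note f = assms(3,4) and g = assms(5,6)
  have diff: "f differentiable (at x)" "g differentiable (at y)" for x y
    using f g by (simp_all add: smooth_def)
  have adj: "x \<bullet> (transpose B *v y) = (B *v x) \<bullet> y" for x y
    by (metis dot_lmul_matrix inner_commute vector_transpose_matrix transpose_transpose)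
  obtain \<beta> where step: "0 < \<alpha>" "\<alpha>\<^sup>2 * (Lf - \<mu>f) \<le> \<beta> * \<mu>f" "\<alpha>\<^sup>2 * (Lg - \<mu>g) \<le> \<beta> * \<mu>g"
      "\<alpha> * spectral_norm B \<le> (1 - \<beta>) * sqrt (\<mu>f * \<mu>g)"
    using assms(1,2,8) f g by (blast intro: strong_convexity_le_smoothness elim: optimal_stepE)
  note cross = cross_terms_le[OF f g step]

  have stat_u: "grad f us = - (transpose B *v ps)"
    using assms(7)
    by (intro grad_at_minimum_of_linear_perturbation diff)
      (simp add: saddle_point_def adj del: transpose_matrix_vector)
  have stat_p: "grad g ps = - (- (B *v us))"
  proof (intro grad_at_minimum_of_linear_perturbation diff)
    fix y
    have "f us - g y + (B *v us) \<bullet> y \<le> f us - g ps + (B *v us) \<bullet> ps"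
      using assms(7) by (simp add: saddle_point_def)
    then show "g ps + ps \<bullet> - (B *v us) \<le> g y + y \<bullet> - (B *v us)"
      by (simp add: inner_commute)
  qed

  have unscale: "x = \<alpha> *\<^sub>R y" if "(1 / \<alpha>) *\<^sub>R x = y" for x y :: "'c::real_vector"
    using that step(1) by auto
  have U: "u (Suc k) - u k = \<alpha> *\<^sub>R (2 *\<^sub>R v (Suc k) - v k - u (Suc k))"
    and P: "p (Suc k) - p k = \<alpha> *\<^sub>R (2 *\<^sub>R q (Suc k) - q k - p (Suc k))" for k
    by (rule unscale, rule assms(9), rule unscale, rule assms(10))
  \<comment> \<open>Stationarity is added in, so that the forces become differences to the saddle point.\<close>
  have V: "\<mu>f *\<^sub>R (v (Suc k) - v k) = - \<alpha> *\<^sub>R (\<mu>f *\<^sub>R (v (Suc k) - us)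
      + (grad ?F (u k) - grad ?F us) + transpose B *v (q k - ps))" for k
    unfolding unscale[OF assms(11)] grad_shift[OF diff(1)] stat_u
    using assms(1) by (simp add: algebra_simps matrix_vector_mult_diff_distrib)
  have Q: "\<mu>g *\<^sub>R (q (Suc k) - q k) = - \<alpha> *\<^sub>R (\<mu>g *\<^sub>R (q (Suc k) - ps)
      + (grad ?G (p k) - grad ?G ps) + - (B *v (2 *\<^sub>R (v (Suc k) - us) - (v k - us))))" for k
  proof -
    have "\<mu>g *\<^sub>R (\<alpha> *\<^sub>R (y - y' - (1 / \<mu>g) *\<^sub>R (d - 2 *\<^sub>R x' + x)))
        = - \<alpha> *\<^sub>R (\<mu>g *\<^sub>R (y' - s) + (d - \<mu>g *\<^sub>R y - (w - \<mu>g *\<^sub>R s))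
          + - (2 *\<^sub>R (x' - w) - (x - w)))" for y y' d x x' s w :: "'c::real_vector"
      using assms(2) by (simp add: algebra_simps scaleR_2)
    then show ?thesis
      unfolding unscale[OF assms(12)] grad_shift[OF diff(2)] stat_p
        matrix_vector_mult_diff_distrib matrix_vector_mult_scaleR minus_minus .
  qed

  have E\<alpha>_alt: "?E\<alpha> k = ?E k - \<alpha> * ((grad ?F (u k) - grad ?F us) \<bullet> (v k - us))
      - \<alpha> * ((grad ?G (p k) - grad ?G ps) \<bullet> (q k - ps)) - \<alpha> * ((B *v (v k - us)) \<bullet> (q k - ps))" for k
    unfolding lyap_mod_def grad_shift[OF diff(1)] grad_shift[OF diff(2)]
    by (simp add: algebra_simps)

  \<comment> \<open>The coupling forces on the two blocks leave, after the extrapolation, the same structure as the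
    gradients: a difference between consecutive steps and a product of increments.\<close>
  have coupling: "- \<alpha> * ((transpose B *v (q k - ps)) \<bullet> (v (Suc k) - us))
      - \<alpha> * (- (B *v (2 *\<^sub>R (v (Suc k) - us) - (v k - us))) \<bullet> (q (Suc k) - ps))
      = \<alpha> * ((B *v (v (Suc k) - us)) \<bullet> (q (Suc k) - ps)) - \<alpha> * ((B *v (v k - us)) \<bullet> (q k - ps))
        + \<alpha> * ((B *v (v (Suc k) - v k)) \<bullet> (q (Suc k) - q k))" for k
  proof -
    have "(transpose B *v (q k - ps)) \<bullet> (v (Suc k) - us) = (B *v (v (Suc k) - us)) \<bullet> (q k - ps)"
      by (metis adj inner_commute)
    then show ?thesis
      by (simp only:)
        (simp add: algebra_simps matrix_vector_mult_diff_distrib matrix_vector_mult_scaleR)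
  qed

  have E\<alpha>_nonneg: "0 \<le> ?E\<alpha> k" for k
  proof -
    have "\<alpha> * ((B *v (v k - us)) \<bullet> (q k - ps)) \<le> \<alpha> * \<bar>(B *v (v k - us)) \<bullet> (q k - ps)\<bar>"
      using step(1) by (intro mult_left_mono) auto
    with cross[of "u k" us "v k - us" "p k" ps "q k - ps"] show ?thesis
      unfolding E\<alpha>_alt lyap_def by linarith
  qed

  \<comment> \<open>The energy of the increment is spent on the products of increments; the cross-term bound is
    used at \<open>v k - v (Suc k)\<close> because the divergence that is available is
    \<open>bregman F (u k) (u (Suc k))\<close>, whose gradient difference is \<open>grad F (u k) - grad F (u (Suc k))\<close>.\<close>
  have descent: "?E\<alpha> (Suc k) - ?E\<alpha> k \<le> - \<alpha> * ?E (Suc k)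
      - \<alpha> * (bregman ?F us (u (Suc k)) + bregman ?G ps (p (Suc k))
        + \<mu>f / 2 * (norm (v (Suc k) - us))\<^sup>2 + \<mu>g / 2 * (norm (q (Suc k) - ps))\<^sup>2)" for k
  proof -
    note block_energy_identity[OF U V, of k]
    moreover note block_energy_identity[OF P Q, of k]
    moreover note coupling[of k]
    moreover have "\<alpha> * ((grad ?F (u (Suc k)) - grad ?F (u k)) \<bullet> (v (Suc k) - v k))
        + \<alpha> * ((grad ?G (p (Suc k)) - grad ?G (p k)) \<bullet> (q (Suc k) - q k))
        + \<alpha> * ((B *v (v (Suc k) - v k)) \<bullet> (q (Suc k) - q k))
        \<le> bregman ?F (u k) (u (Suc k)) + bregman ?G (p k) (p (Suc k))
          + \<mu>f / 2 * (norm (v (Suc k) - v k))\<^sup>2 + \<mu>g / 2 * (norm (q (Suc k) - q k))\<^sup>2"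
    proof -
      have "\<alpha> * ((B *v (v (Suc k) - v k)) \<bullet> (q (Suc k) - q k))
          \<le> \<alpha> * \<bar>(B *v (v k - v (Suc k))) \<bullet> (q k - q (Suc k))\<bar>"
        using step(1) by (intro mult_left_mono)
          (auto simp: algebra_simps matrix_vector_mult_diff_distrib)
      with cross[of "u k" "u (Suc k)" "v k - v (Suc k)" "p k" "p (Suc k)" "q k - q (Suc k)"]
      show ?thesis
        by (simp add: norm_minus_commute inner_diff_left inner_diff_right algebra_simps)
    qed
    ultimately show ?thesis
      unfolding E\<alpha>_alt lyap_def by (simp add: algebra_simps)
  qed

  \<comment> \<open>The dual energy of the new point dominates \<open>E\<alpha> - E\<close> there, by the cross-term bound with the
    saddle point as first argument of the divergences.\<close>
  have contract: "(1 + \<alpha>) * ?E\<alpha> (Suc k) \<le> ?E\<alpha> k" for k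
  proof -
    let ?R = "bregman ?F us (u (Suc k)) + bregman ?G ps (p (Suc k))
        + \<mu>f / 2 * (norm (v (Suc k) - us))\<^sup>2 + \<mu>g / 2 * (norm (q (Suc k) - ps))\<^sup>2"
    have "\<alpha> * - ((B *v (v (Suc k) - us)) \<bullet> (q (Suc k) - ps))
        \<le> \<alpha> * \<bar>(B *v (v (Suc k) - us)) \<bullet> (q (Suc k) - ps)\<bar>"
      using step(1) by (intro mult_left_mono) auto
    with cross[of us "u (Suc k)" "v (Suc k) - us" ps "p (Suc k)" "q (Suc k) - ps"]
    have "?E\<alpha> (Suc k) - ?E (Suc k) \<le> ?R"
      unfolding E\<alpha>_alt by (simp add: inner_diff_left algebra_simps)
    then have "\<alpha> * (?E\<alpha> (Suc k) - ?E (Suc k)) \<le> \<alpha> * ?R"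
      using step(1) by (intro mult_left_mono) auto
    with descent[of k] show ?thesis
      by (simp add: algebra_simps)
  qed
  have E_le: "\<alpha> * ?E (Suc k) \<le> ?E\<alpha> k" for k
  proof -
    have "0 \<le> \<alpha> * (bregman ?F us (u (Suc k)) + bregman ?G ps (p (Suc k))
        + \<mu>f / 2 * (norm (v (Suc k) - us))\<^sup>2 + \<mu>g / 2 * (norm (q (Suc k) - ps))\<^sup>2)"
      using bregman_shift_bounds(1)[OF f] bregman_shift_bounds(1)[OF g] assms(1,2) step(1) by simp
    with descent[of k] E\<alpha>_nonneg[of "Suc k"] show ?thesis
      by linarith
  qed
  have rate: "?E\<alpha> k \<le> (1 / (1 + \<alpha>)) ^ k * ?E\<alpha> 0" for k
  proof (induction k)
    case (Suc k)
    have "?E\<alpha> (Suc k) \<le> 1 / (1 + \<alpha>) * ?E\<alpha> k"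
      using contract[of k] step(1) by (simp add: field_simps)
    also have "\<dots> \<le> 1 / (1 + \<alpha>) * ((1 / (1 + \<alpha>)) ^ k * ?E\<alpha> 0)"
      using Suc.IH step(1) by (intro mult_left_mono) auto
    finally show ?case
      by simp
  qed simp
  have "?E (Suc k) \<le> 1 / \<alpha> * (1 / (1 + \<alpha>)) ^ k * ?E\<alpha> 0" for k
  proof -
    have "\<alpha> * ?E (Suc k) \<le> (1 / (1 + \<alpha>)) ^ k * ?E\<alpha> 0"
      using E_le rate by (rule order_trans)
    then show ?thesis
      using step(1) by (simp add: pos_le_divide_eq mult.commute)
  qed
  with rate show ?thesis
    unfolding Suc_eq_plus1[symmetric] by blast
qed

end
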